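(* Let $\Xi\subset\mathbb{R}^d$ be a polyhedron, let $\bm\zeta_0$ be any vertex of $\Xi$, and suppose there are $p$ edges of $\Xi$ incident to $\bm\zeta_0$. If $p=\dim(\Xi)$, then any recourse system $\bm W\bm y+\bm H\bm\xi\ge\bm b$ (with $\bm W\in\mathbb{R}^{m\times r}$, $\bm H\in\mathbb{R}^{m\times d}$, $\bm b\in\mathbb{R}^m$) that is globally feasible on $\Xi$ is also locally linear feasible at $\bm\zeta_0$.
   Context: Vector inequalities are componentwise. $\dim(\Xi)$ is the affine dimension of $\Xi$. An edge of $\Xi$ is a one-dimensional face of $\Xi$ (possibly unbounded). A recourse system is $\bm W\bm y+\bm H\bm\xi\ge\bm b$, with unknown $\bm y\in\mathbb{R}^r$ and parameter $\bm\xi\in\Xi$. Globally feasible on $\Xi$: there exists a function $\bm y:\mathbb{R}^d\to\mathbb{R}^r$ such that $\bm W\bm y(\bm\xi)+\bm H\bm\xi\ge\bm b$ for every $\bm\xi\in\Xi$. Locally linear feasible at a vertex $\bm\zeta_0$ of $\Xi$: there exist $\epsilon>0$ and an affine function $\bm y(\bm\xi)=\bm y_0+\bm Y\bm\xi$ with $\bm y_0\in\mathbb{R}^r$, $\bm Y\in\mathbb{R}^{r\times d}$, such that $\bm W\bm y(\bm\xi)+\bm H\bm\xi\ge\bm b$ for all $\bm\xi\in\Xi\cap B(\bm\zeta_0,\epsilon)$, where $B(\bm\zeta_0,\epsilon)$ is the ball of radius $\epsilon$ centered at $\bm\zeta_0$. *)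

theory Defs
  imports "HOL-Analysis.Analysis"
begin

text \<open>The order on \<^typ>\<open>real ^ 'm\<close> is componentwise (\<open>less_eq_vec_def\<close>).\<close>

definition globally_feasible ::
  "real ^ 'r ^ 'm \<Rightarrow> real ^ 'd ^ 'm \<Rightarrow> real ^ 'm \<Rightarrow> (real ^ 'd) set \<Rightarrow> bool"
  where "globally_feasible W H b \<Xi> \<longleftrightarrow>
    (\<exists>y :: real ^ 'd \<Rightarrow> real ^ 'r. \<forall>\<xi>\<in>\<Xi>. W *v y \<xi> + H *v \<xi> \<ge> b)"

definition locally_linear_feasible ::
  "real ^ 'r ^ 'm \<Rightarrow> real ^ 'd ^ 'm \<Rightarrow> real ^ 'm \<Rightarrow> (real ^ 'd) set \<Rightarrow> real ^ 'd \<Rightarrow> bool"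
  where "locally_linear_feasible W H b \<Xi> \<zeta>\<^sub>0 \<longleftrightarrow>
    (\<exists>\<epsilon>>0. \<exists>(y\<^sub>0 :: real ^ 'r) (Y :: real ^ 'd ^ 'r).
       \<forall>\<xi>\<in>\<Xi> \<inter> ball \<zeta>\<^sub>0 \<epsilon>. W *v (y\<^sub>0 + Y *v \<xi>) + H *v \<xi> \<ge> b)"

definition incident_edges :: "'a::euclidean_space set \<Rightarrow> 'a \<Rightarrow> 'a set set"
  where "incident_edges \<Xi> \<zeta> = {e. e edge_of \<Xi> \<and> \<zeta> \<in> e}"

end

theory Submission
  imports Defs
begin

text \<open>
  A polyhedron lies in the cone spanned at a vertex \<open>z\<close> by its edges through \<open>z\<close>
  (\<open>polyhedron_in_cone_of_incident_edges\<close>). Choose one point \<open>v \<noteq> z\<close> on each of these edges;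
  the differences \<open>v - z\<close> then span the directions of the polyhedron, and when there are only
  as many edges as dimensions they must be linearly independent. Hence there is an affine map
  that agrees with a given feasible recourse at \<open>z\<close> and at all the chosen points \<open>v\<close>. Near
  \<open>z\<close>, every point of the polyhedron is a convex combination of \<open>z\<close> and the points \<open>v\<close>, and
  since the recourse constraints are jointly affine in parameter and recourse, feasibility is
  inherited from these finitely many points.

  The cone lemma goes by induction on the dimension. Subtracting from a point \<open>x\<close> a
  multiple of a direction \<open>w - z\<close> into the polyhedron must, as \<open>z\<close> is a vertex, eventually
  bring one of the constraints active at \<open>z\<close> to equality (\<open>subtract_direction_into_face\<close>).
  If \<open>w\<close> lies in a proper face through \<open>z\<close>, this splits \<open>x - z\<close> into two directions that both
  belong to proper faces, where the induction hypothesis applies.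
\<close>

section \<open>Directions at a vertex of a polyhedron\<close>

text \<open>A constraint that is slack at \<open>z\<close> survives every small step, so only the active ones
  restrict the directions that lead from \<open>z\<close> into the polyhedron.\<close>

lemma small_step_along_active_directions:
  fixes a :: "'i \<Rightarrow> 'a::real_inner"
  assumes "finite I"
    and z: "\<And>i. i \<in> I \<Longrightarrow> a i \<bullet> z \<le> \<beta> i"
    and d: "\<And>i. i \<in> I \<Longrightarrow> a i \<bullet> z = \<beta> i \<Longrightarrow> a i \<bullet> d \<le> 0"
  shows "\<exists>s>0. \<forall>i\<in>I. a i \<bullet> (z + s *\<^sub>R d) \<le> \<beta> i"
proof -
  have "\<forall>\<^sub>F s in at_right (0::real). a i \<bullet> (z + s *\<^sub>R d) \<le> \<beta> i" if "i \<in> I" for i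
  proof (cases "a i \<bullet> z = \<beta> i")
    case True
    then have "a i \<bullet> (z + s *\<^sub>R d) \<le> \<beta> i" if "s > 0" for s
      using d[OF \<open>i \<in> I\<close> True] that by (simp add: inner_add_right mult_nonneg_nonpos)
    then show ?thesis
      by (simp add: eventually_at_right_less eventually_mono[OF eventually_at_right_less])
  next
    case False
    then have "a i \<bullet> z < \<beta> i" using z[OF that] by simp
    moreover have "((\<lambda>s. a i \<bullet> (z + s *\<^sub>R d)) \<longlongrightarrow> a i \<bullet> (z + 0 *\<^sub>R d)) (at_right (0::real))"
      by (intro tendsto_intros)
    ultimately have "\<forall>\<^sub>F s in at_right (0::real). a i \<bullet> (z + s *\<^sub>R d) < \<beta> i"
      by (intro order_tendstoD(2)[where y = "a i \<bullet> (z + 0 *\<^sub>R d)"]) auto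
    then show ?thesis by (rule eventually_mono) simp
  qed
  then have "\<forall>\<^sub>F s in at_right (0::real). \<forall>i\<in>I. a i \<bullet> (z + s *\<^sub>R d) \<le> \<beta> i"
    using \<open>finite I\<close> by (simp add: eventually_ball_finite)
  then have "\<forall>\<^sub>F s in at_right (0::real). s > 0 \<and> (\<forall>i\<in>I. a i \<bullet> (z + s *\<^sub>R d) \<le> \<beta> i)"
    by (intro eventually_conj) (simp add: eventually_at_right_less)
  then show ?thesis
    using eventually_happens'[OF trivial_limit_at_right_real] by blast
qed

text \<open>If the opposite direction \<open>z - w\<close> respected all active constraints, then \<open>z\<close> would be
  interior to a segment in the polyhedron. So \<open>w - z\<close> is strictly inside some of them, and
  moving from \<open>x\<close> against \<open>w - z\<close> makes a first such constraint tight. The point reached may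
  violate slack constraints, which is why it is scaled towards \<open>z\<close>.\<close>

lemma subtract_direction_into_face:
  fixes P :: "'a::euclidean_space set"
  assumes "polyhedron P" and ext: "z extreme_point_of P"
    and "x \<in> P" and "w \<in> P" and "w \<noteq> z"
  obtains t s G where "t \<ge> 0" "s > 0" "G face_of P" "G \<noteq> P" "z \<in> G"
    "z + s *\<^sub>R (x - z - t *\<^sub>R (w - z)) \<in> G"
proof -
  obtain I where "finite I" and P: "P = \<Inter>I"
    and "\<forall>h\<in>I. \<exists>a \<beta>. a \<noteq> 0 \<and> h = {y. a \<bullet> y \<le> \<beta>}"
    using \<open>polyhedron P\<close> unfolding polyhedron_def by blast
  then obtain a \<beta> where h: "\<And>h. h \<in> I \<Longrightarrow> h = {y. a h \<bullet> y \<le> \<beta> h}"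
    by metis
  have inP: "y \<in> P \<longleftrightarrow> (\<forall>h\<in>I. a h \<bullet> y \<le> \<beta> h)" for y
    using h unfolding P by blast
  have "z \<in> P" using ext by (simp add: extreme_point_of_def)
  define A where "A = {h \<in> I. a h \<bullet> z = \<beta> h}"
  have active: "a h \<bullet> (y - z) \<le> 0" if "h \<in> A" "y \<in> P" for h y
    using that by (auto simp: A_def inP inner_diff_right)
  define B where "B = {h \<in> A. a h \<bullet> (w - z) < 0}"
  have "finite B" using \<open>finite I\<close> by (simp add: A_def B_def)
  have "B \<noteq> {}"
  proof
    assume "B = {}"
    then have "\<And>h. h \<in> I \<Longrightarrow> a h \<bullet> z = \<beta> h \<Longrightarrow> a h \<bullet> (z - w) \<le> 0"
      by (force simp: A_def B_def inner_diff_right)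
    with small_step_along_active_directions[OF \<open>finite I\<close>, of a z \<beta> "z - w"] \<open>z \<in> P\<close>
    obtain s where "s > 0" and s: "z + s *\<^sub>R (z - w) \<in> P"
      by (auto simp: inP)
    have "z \<in> open_segment w (z + s *\<^sub>R (z - w))"
      unfolding in_segment
    proof (intro conjI exI)
      show "w \<noteq> z + s *\<^sub>R (z - w)"
      proof
        assume "w = z + s *\<^sub>R (z - w)"
        then have "(1 + s) *\<^sub>R (z - w) = 0" by (simp add: algebra_simps)
        with \<open>s > 0\<close> \<open>w \<noteq> z\<close> show False by simp
      qed
      show "0 < 1 / (1 + s)" "1 / (1 + s) < 1" using \<open>s > 0\<close> by auto
      have "w + (1 / (1 + s)) *\<^sub>R ((1 + s) *\<^sub>R (z - w)) = z"
        using \<open>s > 0\<close> by simp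
      then show "z = (1 - 1 / (1 + s)) *\<^sub>R w + (1 / (1 + s)) *\<^sub>R (z + s *\<^sub>R (z - w))"
        by (simp add: algebra_simps)
    qed
    then show False using ext \<open>w \<in> P\<close> s by (auto simp: extreme_point_of_def)
  qed
  \<comment> \<open>\<open>r h\<close> is the step length at which constraint \<open>h\<close> becomes tight.\<close>
  define r where "r h = (a h \<bullet> (x - z)) / (a h \<bullet> (w - z))" for h
  define t where "t = Min (r ` B)"
  have "t \<in> r ` B"
    unfolding t_def using \<open>finite B\<close> \<open>B \<noteq> {}\<close> by (intro Min_in) auto
  then obtain k where k: "k \<in> B" "t = r k" by blast
  have kA: "k \<in> I" "k \<in> A" "a k \<bullet> z = \<beta> k" "a k \<bullet> (w - z) < 0"
    using k by (auto simp: A_def B_def)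
  have "t \<ge> 0"
    using kA active[OF kA(2) \<open>x \<in> P\<close>] by (simp add: k r_def divide_nonpos_neg)
  let ?d = "x - z - t *\<^sub>R (w - z)"
  have "a h \<bullet> ?d \<le> 0" if "h \<in> I" "a h \<bullet> z = \<beta> h" for h
  proof (cases "h \<in> B")
    case True
    then have "t \<le> r h" using \<open>finite B\<close> by (simp add: t_def)
    moreover have "a h \<bullet> (w - z) < 0" using True by (simp add: B_def)
    ultimately have "a h \<bullet> (x - z) \<le> t * (a h \<bullet> (w - z))"
      by (simp add: r_def neg_le_divide_eq)
    then show ?thesis by (simp add: inner_diff_right)
  next
    case False
    have "h \<in> A" using that by (simp add: A_def)
    then have "a h \<bullet> (w - z) = 0"
      using False active[OF _ \<open>w \<in> P\<close>, of h] by (force simp: B_def)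
    then show ?thesis
      using active[OF \<open>h \<in> A\<close> \<open>x \<in> P\<close>] by (simp add: inner_diff_right[of _ "x - z"])
  qed
  with small_step_along_active_directions[OF \<open>finite I\<close>, of a z \<beta> ?d] \<open>z \<in> P\<close>
  obtain s where "s > 0" and s: "z + s *\<^sub>R ?d \<in> P"
    by (auto simp: inP)
  have "a k \<bullet> ?d = 0"
    using kA by (simp add: inner_diff_right[of _ "x - z"] k r_def)
  then have tight: "a k \<bullet> (z + s *\<^sub>R ?d) = \<beta> k"
    using kA by (simp only: inner_add_right inner_scaleR_right)
  let ?G = "P \<inter> {y. a k \<bullet> y = \<beta> k}"
  have "?G face_of P"
    using kA inP \<open>polyhedron P\<close>
    by (intro face_of_Int_supporting_hyperplane_le) (auto simp: polyhedron_imp_convex)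
  moreover have "w \<notin> ?G" using kA by (simp add: inner_diff_right)
  then have "?G \<noteq> P" using \<open>w \<in> P\<close> by blast
  moreover have "z \<in> ?G" using \<open>z \<in> P\<close> kA by simp
  moreover have "z + s *\<^sub>R ?d \<in> ?G" using s tight by simp
  ultimately show thesis using that \<open>t \<ge> 0\<close> \<open>s > 0\<close> by blast
qed

text \<open>In dimension one an extreme point is an end point, so everything lies on one side
  of it.\<close>

lemma collinear_on_one_side_of_extreme_point:
  fixes z :: "'a::euclidean_space"
  assumes "collinear e" and ext: "z extreme_point_of e"
    and "v \<in> e" "v \<noteq> z" "w \<in> e"
  obtains c where "c \<ge> 0" "w - z = c *\<^sub>R (v - z)"
proof -
  have "z \<in> e" using ext by (simp add: extreme_point_of_def)
  then have "collinear {v, z, w}"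
    using assms by (auto intro: collinear_subset)
  then have "v - z = 0 \<or> w - z = 0 \<or> (\<exists>c. w - z = c *\<^sub>R (v - z))"
    by (simp add: collinear_3 collinear_lemma)
  moreover have "w - z = 0 *\<^sub>R (v - z)" if "w - z = 0"
    using that by simp
  ultimately obtain c where c: "w - z = c *\<^sub>R (v - z)"
    using \<open>v \<noteq> z\<close> by force
  moreover have "c \<ge> 0"
  proof (rule ccontr)
    assume "\<not> c \<ge> 0"
    then have "c < 0" by simp
    have "z \<in> open_segment w v"
      unfolding in_segment
    proof (intro conjI exI)
      show "w \<noteq> v"
      proof
        assume "w = v"
        with c have "(1 - c) *\<^sub>R (v - z) = 0" by (simp add: algebra_simps)
        with \<open>c < 0\<close> \<open>v \<noteq> z\<close> show False by simp
      qed
      show "0 < - c / (1 - c)" "- c / (1 - c) < 1"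
        using \<open>c < 0\<close> by (auto simp: divide_simps)
      have w: "w = c *\<^sub>R v + (1 - c) *\<^sub>R z" using c by (simp add: algebra_simps)
      have "1 - - c / (1 - c) = 1 / (1 - c)"
        using \<open>c < 0\<close> by (simp add: field_simps)
      then have "(1 - - c / (1 - c)) *\<^sub>R w = (c / (1 - c)) *\<^sub>R v + z"
        using \<open>c < 0\<close> by (simp add: w scaleR_add_right)
      then show "z = (1 - - c / (1 - c)) *\<^sub>R w + (- c / (1 - c)) *\<^sub>R v"
        by simp
    qed
    then show False using ext \<open>v \<in> e\<close> \<open>w \<in> e\<close> by (auto simp: extreme_point_of_def)
  qed
  ultimately show thesis using that by blast
qed

text \<open>The directions in proper faces are covered by induction on the dimension, because an
  edge of a face is an edge of the whole polyhedron. A further point of a proper face through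
  \<open>z\<close> is found by subtracting from \<open>x\<close> a direction not parallel to \<open>x - z\<close>; subtracting then
  the direction of that point leaves only directions in proper faces.\<close>

lemma polyhedron_in_cone_of_incident_edges:
  fixes P :: "'a::euclidean_space set"
  assumes "convex_cone K"
    and "polyhedron P" and "z extreme_point_of P"
    and "\<And>e w. e \<in> incident_edges P z \<Longrightarrow> w \<in> e \<Longrightarrow> w - z \<in> K"
    and "x \<in> P"
  shows "x - z \<in> K"
  using assms(2-5)
proof (induction "nat (aff_dim P)" arbitrary: P x rule: less_induct)
  case less
  have "convex P" using less.prems polyhedron_imp_convex by blast
  have "z \<in> P" using less.prems by (simp add: extreme_point_of_def)
  have face: "y - z \<in> K" if G: "G face_of P" "G \<noteq> P" "z \<in> G" "y \<in> G" for G y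
  proof (rule less.hyps[of G])
    have "aff_dim G < aff_dim P"
      using G \<open>convex P\<close> face_of_aff_dim_lt by blast
    moreover have "aff_dim G \<ge> 0"
      using G(3) aff_dim_negative_iff[of G] by (metis empty_iff not_less)
    ultimately show "nat (aff_dim G) < nat (aff_dim P)" by simp
    show "polyhedron G" using G less.prems face_of_polyhedron_polyhedron by blast
    show "z extreme_point_of G"
      using G less.prems(2) extreme_point_of_face by blast
    show "w - z \<in> K" if "e \<in> incident_edges G z" "w \<in> e" for e w
      using that less.prems(3) G face_of_trans
      by (force simp: incident_edges_def edge_of_def)
    show "y \<in> G" by fact
  qed
  show ?case
  proof (cases "x = z")
    case True
    then show ?thesis using assms(1) by (simp add: convex_cone_contains_0)
  next
    case False
    show ?thesis
    proof (cases "collinear P")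
      case True
      have "aff_dim {x, z} \<le> aff_dim P"
        using \<open>x \<in> P\<close> \<open>z \<in> P\<close> by (intro aff_dim_subset) auto
      then have "aff_dim P = 1"
        using True False by (simp add: collinear_aff_dim aff_dim_2)
      then have "P \<in> incident_edges P z"
        using \<open>z \<in> P\<close> \<open>convex P\<close> by (simp add: incident_edges_def edge_of_def face_of_refl)
      then show ?thesis using less.prems by blast
    next
      case not_collinear: False
      have "\<exists>w\<in>P. \<forall>c. w - z \<noteq> c *\<^sub>R (x - z)"
      proof (rule ccontr)
        assume "\<not> ?thesis"
        then have "\<forall>w\<in>P. \<exists>c. w = z + c *\<^sub>R (x - z)"
          by (metis add_diff_cancel_left' diff_add_cancel add.commute)
        then have "collinear P" using collinear_alt by blast
        with not_collinear show False ..
      qed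
      then obtain w where "w \<in> P" and w: "\<And>c. w - z \<noteq> c *\<^sub>R (x - z)" by blast
      have "w \<noteq> z" using w[of 0] by auto
      obtain t s G where 1: "t \<ge> 0" "s > 0" "G face_of P" "G \<noteq> P" "z \<in> G"
        "z + s *\<^sub>R (x - z - t *\<^sub>R (w - z)) \<in> G"
        using subtract_direction_into_face[OF less.prems(1,2) \<open>x \<in> P\<close> \<open>w \<in> P\<close> \<open>w \<noteq> z\<close>] .
      define v where "v = z + s *\<^sub>R (x - z - t *\<^sub>R (w - z))"
      have "v \<noteq> z"
      proof
        assume "v = z"
        then have eq: "x - z = t *\<^sub>R (w - z)" using \<open>s > 0\<close> by (simp add: v_def)
        then have "t \<noteq> 0" using \<open>x \<noteq> z\<close> by auto
        then have "w - z = inverse t *\<^sub>R (x - z)" by (simp add: eq)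
        with w show False by blast
      qed
      have "v \<in> G" using 1 by (simp add: v_def)
      then have "v - z \<in> K" "v \<in> P" using face 1 face_of_imp_subset by blast+
      obtain t' s' G' where 2: "t' \<ge> 0" "s' > 0" "G' face_of P" "G' \<noteq> P" "z \<in> G'"
        "z + s' *\<^sub>R (x - z - t' *\<^sub>R (v - z)) \<in> G'"
        using subtract_direction_into_face[OF less.prems(1,2) \<open>x \<in> P\<close> \<open>v \<in> P\<close> \<open>v \<noteq> z\<close>] .
      have "s' *\<^sub>R (x - z - t' *\<^sub>R (v - z)) \<in> K"
        using face[OF 2(3-6)] by simp
      moreover have "inverse s' \<ge> 0" using \<open>s' > 0\<close> by simp
      ultimately have "inverse s' *\<^sub>R (s' *\<^sub>R (x - z - t' *\<^sub>R (v - z))) \<in> K"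
        using assms(1) convex_cone_scaleR by blast
      moreover have "t' *\<^sub>R (v - z) \<in> K"
        using assms(1) \<open>t' \<ge> 0\<close> \<open>v - z \<in> K\<close> by (intro convex_cone_scaleR)
      ultimately have "inverse s' *\<^sub>R (s' *\<^sub>R (x - z - t' *\<^sub>R (v - z))) + t' *\<^sub>R (v - z) \<in> K"
        using assms(1) by (intro convex_cone_add)
      then show ?thesis using \<open>s' > 0\<close> by simp
    qed
  qed
qed

text \<open>The case of equally many edges and dimensions: spanning already forces the edge
  directions to be independent.\<close>

lemma simple_vertex_cone_basis:
  fixes P :: "'a::euclidean_space set"
  assumes P: "polyhedron P" and z: "z extreme_point_of P"
    and simple: "int (card (incident_edges P z)) = aff_dim P"
  obtains D where "finite D" "independent D" "\<And>d. d \<in> D \<Longrightarrow> z + d \<in> P"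
    "\<And>x. x \<in> P \<Longrightarrow> \<exists>l. (\<forall>d\<in>D. 0 \<le> l d) \<and> x - z = (\<Sum>d\<in>D. l d *\<^sub>R d)"
proof -
  let ?E = "incident_edges P z"
  have "z \<in> P" using z by (simp add: extreme_point_of_def)
  have "finite ?E"
    using finite_polyhedron_faces[OF P]
    by (rule rev_finite_subset) (auto simp: incident_edges_def edge_of_def)
  have "\<exists>v\<in>e. v \<noteq> z" if "e \<in> ?E" for e
  proof (rule ccontr)
    assume "\<not> ?thesis"
    then have "e = {z}" using that by (auto simp: incident_edges_def)
    then show False using that by (simp add: incident_edges_def edge_of_def)
  qed
  then obtain v where v: "\<And>e. e \<in> ?E \<Longrightarrow> v e \<in> e \<and> v e \<noteq> z" by metis
  define D where "D = (\<lambda>e. v e - z) ` ?E"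
  have "finite D" using \<open>finite ?E\<close> by (simp add: D_def)
  have DP: "z + d \<in> P" if "d \<in> D" for d
    using that v face_of_imp_subset by (fastforce simp: D_def incident_edges_def edge_of_def)
  define K where "K = {\<Sum>d\<in>D. l d *\<^sub>R d | l. \<forall>d\<in>D. (0::real) \<le> l d}"
  have "convex_cone K"
    unfolding convex_cone_iff
  proof (intro conjI ballI allI impI)
    show "0 \<in> K"
      unfolding K_def by (rule CollectI, rule exI[of _ "\<lambda>_. 0"]) simp
    show "x + y \<in> K" if xy: "x \<in> K" "y \<in> K" for x y
    proof -
      obtain l m where "\<forall>d\<in>D. 0 \<le> l d" "x = (\<Sum>d\<in>D. l d *\<^sub>R d)"
        "\<forall>d\<in>D. 0 \<le> m d" "y = (\<Sum>d\<in>D. m d *\<^sub>R d)"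
        using xy unfolding K_def by blast
      then show ?thesis
        unfolding K_def
        by (intro CollectI exI[of _ "\<lambda>d. l d + m d"]) (simp add: scaleR_add_left sum.distrib)
    qed
    show "c *\<^sub>R x \<in> K" if xc: "x \<in> K" "0 \<le> c" for x c
    proof -
      obtain l where "\<forall>d\<in>D. 0 \<le> l d" "x = (\<Sum>d\<in>D. l d *\<^sub>R d)"
        using xc unfolding K_def by blast
      then show ?thesis
        using \<open>0 \<le> c\<close> unfolding K_def
        by (intro CollectI exI[of _ "\<lambda>d. c * l d"]) (simp add: scaleR_sum_right)
    qed
  qed
  have "d \<in> K" if "d \<in> D" for d
    using that \<open>finite D\<close> unfolding K_def
    by (intro CollectI exI[of _ "\<lambda>d'. if d' = d then 1 else 0"])
       (simp add: if_distrib[of "\<lambda>c. c *\<^sub>R _"] sum.delta cong: if_cong)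
  have edges: "w - z \<in> K" if ew: "e \<in> ?E" "w \<in> e" for e w
  proof -
    have "collinear e" "z extreme_point_of e"
      using ew z extreme_point_of_face
      by (auto simp: incident_edges_def edge_of_def collinear_aff_dim)
    then obtain c where "c \<ge> 0" "w - z = c *\<^sub>R (v e - z)"
      using collinear_on_one_side_of_extreme_point v[OF ew(1)] ew(2) by metis
    moreover have "v e - z \<in> K" using \<open>\<And>d. d \<in> D \<Longrightarrow> d \<in> K\<close> ew by (simp add: D_def)
    ultimately show ?thesis using \<open>convex_cone K\<close> convex_cone_scaleR by metis
  qed
  have PK: "x - z \<in> K" if "x \<in> P" for x
    using polyhedron_in_cone_of_incident_edges[OF \<open>convex_cone K\<close> P z edges that] .
  have "K \<subseteq> span D"
    unfolding K_def by (auto intro: span_sum span_scale span_base)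
  have "independent D"
  proof (rule card_le_dim_spanning)
    have "(+) (- z) ` P \<subseteq> span D" using PK \<open>K \<subseteq> span D\<close> by force
    then have "dim ((+) (- z) ` P) \<le> dim (span D)" by (rule dim_subset)
    moreover have "aff_dim P = int (dim ((+) (- z) ` P))"
      using \<open>z \<in> P\<close> by (intro aff_dim_eq_dim) (simp add: hull_inc)
    moreover have "card D \<le> card ?E"
      using \<open>finite ?E\<close> by (simp add: D_def card_image_le)
    ultimately show "card D \<le> dim (span D)" using simple by linarith
  qed (use \<open>finite D\<close> span_superset in auto)
  moreover have "\<exists>l. (\<forall>d\<in>D. 0 \<le> l d) \<and> x - z = (\<Sum>d\<in>D. l d *\<^sub>R d)" if "x \<in> P" for x
    using PK[OF that] unfolding K_def by blast
  ultimately show thesis using that \<open>finite D\<close> DP by blast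
qed

section \<open>Affine recourse near a simple vertex\<close>

theorem theorem2:
  fixes \<Xi> :: "(real ^ 'd) set" and \<zeta>\<^sub>0 :: "real ^ 'd" and p :: nat
    and W :: "real ^ 'r ^ 'm" and H :: "real ^ 'd ^ 'm" and b :: "real ^ 'm"
  assumes "polyhedron \<Xi>"
    and "\<zeta>\<^sub>0 extreme_point_of \<Xi>"
    and "card (incident_edges \<Xi> \<zeta>\<^sub>0) = p"
    and "int p = aff_dim \<Xi>"
    and "globally_feasible W H b \<Xi>"
  shows "locally_linear_feasible W H b \<Xi> \<zeta>\<^sub>0"
proof -
  let ?z = "\<zeta>\<^sub>0"
  have "?z \<in> \<Xi>" using assms(2) by (simp add: extreme_point_of_def)
  obtain y where y: "\<And>x. x \<in> \<Xi> \<Longrightarrow> b \<le> W *v y x + H *v x"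
    using assms(5) unfolding globally_feasible_def by blast
  obtain D where "finite D" "independent D" and D\<Xi>: "\<And>d. d \<in> D \<Longrightarrow> ?z + d \<in> \<Xi>"
    and cone: "\<And>x. x \<in> \<Xi> \<Longrightarrow> \<exists>l. (\<forall>d\<in>D. 0 \<le> l d) \<and> x - ?z = (\<Sum>d\<in>D. l d *\<^sub>R d)"
    using simple_vertex_cone_basis[OF assms(1,2)] assms(3,4) by blast
  obtain g :: "real ^ 'd \<Rightarrow> real ^ 'r" where "linear g"
    and g: "\<And>d. d \<in> D \<Longrightarrow> g d = y (?z + d) - y ?z"
    using linear_independent_extend[OF \<open>independent D\<close>, of "\<lambda>d. y (?z + d) - y ?z"] by blast
  \<comment> \<open>\<open>L\<close> reads off the sum of the cone coordinates, so that \<open>L (x - \<zeta>\<^sub>0) \<le> 1\<close> makes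
    a point \<open>x\<close> of the polyhedron a convex combination of \<open>\<zeta>\<^sub>0\<close> and the points \<open>\<zeta>\<^sub>0 + d\<close>.\<close>
  obtain L :: "real ^ 'd \<Rightarrow> real" where "linear L" and L: "\<And>d. d \<in> D \<Longrightarrow> L d = 1"
    using linear_independent_extend[OF \<open>independent D\<close>, of "\<lambda>_. 1"] by blast
  have "isCont L 0" using \<open>linear L\<close> by (simp add: linear_continuous_at linear_conv_bounded_linear)
  then obtain \<epsilon> where "\<epsilon> > 0" and \<epsilon>: "\<And>u. dist u 0 < \<epsilon> \<Longrightarrow> dist (L u) (L 0) < 1"
    unfolding continuous_at_eps_delta by (metis zero_less_one dist_norm)
  define y0 where "y0 = y ?z - g ?z"
  have "b \<le> W *v (y0 + matrix g *v x) + H *v x" if x: "x \<in> \<Xi> \<inter> ball ?z \<epsilon>" for x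
  proof -
    obtain l where l: "\<And>d. d \<in> D \<Longrightarrow> 0 \<le> l d" and xl: "x - ?z = (\<Sum>d\<in>D. l d *\<^sub>R d)"
      using cone x by blast
    have "L (x - ?z) = (\<Sum>d\<in>D. l d)"
      unfolding xl using L by (simp add: linear_sum[OF \<open>linear L\<close>] linear_scale[OF \<open>linear L\<close>])
    moreover have "L (x - ?z) < 1"
      using \<epsilon>[of "x - ?z"] x by (simp add: linear_0[OF \<open>linear L\<close>] dist_norm norm_minus_commute)
    ultimately have l1: "(\<Sum>d\<in>D. l d) \<le> 1" by simp
    define R where "R x = W *v y x + H *v x - b" for x
    have R: "0 \<le> R x $ i" if "x \<in> \<Xi>" for x i
      using y[OF that] by (simp add: R_def less_eq_vec_def)
    have gx: "y0 + matrix g *v x = y ?z + (\<Sum>d\<in>D. l d *\<^sub>R (y (?z + d) - y ?z))"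
    proof -
      have "g x - g ?z = g (x - ?z)" by (simp add: linear_diff[OF \<open>linear g\<close>])
      also have "\<dots> = (\<Sum>d\<in>D. l d *\<^sub>R (y (?z + d) - y ?z))"
        unfolding xl using g
        by (simp add: linear_sum[OF \<open>linear g\<close>] linear_scale[OF \<open>linear g\<close>])
      finally show ?thesis
        by (simp add: y0_def matrix_vector_mul(2)[OF \<open>linear g\<close>] algebra_simps)
    qed
    have Rd: "W *v (y (?z + d) - y ?z) + H *v d = R (?z + d) - R ?z" for d
      by (simp add: R_def matrix_vector_mult_diff_distrib matrix_vector_right_distrib)
    have "W *v (y0 + matrix g *v x) + H *v x - b
        = R ?z + (W *v (\<Sum>d\<in>D. l d *\<^sub>R (y (?z + d) - y ?z)) + H *v (x - ?z))"
      by (simp add: gx R_def matrix_vector_right_distrib matrix_vector_mult_diff_distrib)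
    also have "\<dots> = R ?z + (\<Sum>d\<in>D. l d *\<^sub>R (R (?z + d) - R ?z))"
      unfolding xl
      by (simp only: linear_sum[OF matrix_vector_mul_linear] matrix_vector_mult_scaleR
          sum.distrib scaleR_add_right Rd[symmetric])
    also have "\<dots> = (1 - (\<Sum>d\<in>D. l d)) *\<^sub>R R ?z + (\<Sum>d\<in>D. l d *\<^sub>R R (?z + d))"
      by (simp add: scaleR_diff_right sum_subtractf scaleR_diff_left flip: scaleR_sum_left)
    finally have eq: "W *v (y0 + matrix g *v x) + H *v x - b
        = (1 - (\<Sum>d\<in>D. l d)) *\<^sub>R R ?z + (\<Sum>d\<in>D. l d *\<^sub>R R (?z + d))" .
    have "0 \<le> (W *v (y0 + matrix g *v x) + H *v x - b) $ i" for i
      unfolding eq using l1 l R[OF \<open>?z \<in> \<Xi>\<close>] R[OF D\<Xi>]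
      by (auto intro!: add_nonneg_nonneg mult_nonneg_nonneg sum_nonneg)
    then show ?thesis by (simp add: less_eq_vec_def)
  qed
  then show ?thesis
    unfolding locally_linear_feasible_def using \<open>\<epsilon> > 0\<close> by blast
qed

end
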